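(* Let $p$ be an odd prime for which the multiplicative order of $2$ modulo $p$ is $p-1$, and let $M = \mathbb{F}_2^{p-1} \setminus \{0\}$ be the complete binary matroid of dimension $p-1$. Then $$c(M) = \frac{2^{p-1}-1}{p}.$$
   Context: A (simple) binary matroid is a subset $M \subseteq \mathbb{F}_2^n \setminus \{0\}$ for some $n \ge 1$; the complete binary matroid of dimension $n$ is $\mathbb{F}_2^n \setminus \{0\}$. $M$ is Eulerian if $\sum_{x \in M} x = 0$ in $\mathbb{F}_2^n$. A subset $N \subseteq M$ is a circuit if it is a minimal (with respect to inclusion) non-empty Eulerian subset of $M$. A circuit decomposition of $M$ is a collection of pairwise disjoint circuits of $M$ whose union is $M$; one exists if and only if $M$ is Eulerian. For Eulerian $M$, $c(M)$ denotes the minimum number of circuits in a circuit decomposition of $M$. *)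

theory Defs
  imports
    "HOL-Analysis.Finite_Cartesian_Product"
    "HOL-Library.Z2"
    "HOL-Number_Theory.Number_Theory"
begin

text \<open>
  The space \<open>\<bbbF>\<^sub>2\<^sup>n\<close> is \<^typ>\<open>bit ^ 'n\<close> with \<open>n = CARD('n)\<close>, so \<open>n \<ge> 1\<close> holds automatically.
  A (simple) binary matroid is a set of nonzero vectors of this space.
\<close>

definition complete_matroid :: "(bit ^ 'n) set" where
  "complete_matroid = UNIV - {0}"

definition eulerian :: "(bit ^ 'n) set \<Rightarrow> bool" where
  "eulerian M \<longleftrightarrow> (\<Sum>x\<in>M. x) = 0"

definition circuit :: "(bit ^ 'n) set \<Rightarrow> (bit ^ 'n) set \<Rightarrow> bool" where
  "circuit M N \<longleftrightarrow> N \<subseteq> M \<and> N \<noteq> {} \<and> eulerian N \<and>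
     (\<forall>K. K \<subset> N \<longrightarrow> K \<noteq> {} \<longrightarrow> \<not> eulerian K)"

definition circuit_decomposition ::
    "(bit ^ 'n) set \<Rightarrow> (bit ^ 'n) set set \<Rightarrow> bool" where
  "circuit_decomposition M D \<longleftrightarrow>
     (\<forall>C\<in>D. circuit M C) \<and> pairwise disjnt D \<and> \<Union>D = M"

text \<open>Only meaningful for Eulerian \<open>M\<close>; otherwise no circuit decomposition exists.\<close>

definition min_circuits :: "(bit ^ 'n) set \<Rightarrow> nat" where
  "min_circuits M = (LEAST k. \<exists>D. circuit_decomposition M D \<and> card D = k)"

end

theory Submission
  imports Defs "HOL-Computational_Algebra.Polynomial"
begin

text \<open>
  Write \<open>n = p - 1\<close>. The elements of a circuit other than a fixed one have pairwise distinct subset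
  sums, so a circuit has at most \<open>n + 1 = p\<close> elements (\<open>card_circuit_le\<close>), and any decomposition of
  the \<open>2\<^sup>n - 1\<close> nonzero vectors needs at least \<open>(2\<^sup>n - 1) / p\<close> circuits. It remains to partition the
  nonzero vectors into circuits of exactly \<open>p\<close> elements.

  Identify \<open>\<bbbF>\<^sub>2\<^sup>n\<close> with \<open>\<bbbF>\<^sub>2[x]/(\<Phi>)\<close>, where \<open>\<Phi> = 1 + x + \<dots> + x\<^sup>p\<^sup>-\<^sup>1\<close>. Since \<open>\<Phi>\<close> divides \<open>x\<^sup>p - 1\<close>,
  multiplication by \<open>x\<close> acts on it as a permutation of order \<open>p\<close>, and its nonzero orbits are the wanted
  circuits. Indeed a sum of elements of the orbit of \<open>q\<close> has the form \<open>a q\<close> with \<open>a\<close> the sum of the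
  \<open>x\<^sup>i\<close> for \<open>i\<close> in some \<open>S \<subseteq> {0, \<dots>, p - 1}\<close>. For \<open>S\<close> the whole range, \<open>a = \<Phi>\<close> and the sum vanishes.
  For \<open>S\<close> nonempty and proper, \<open>a\<close> is not divisible by \<open>\<Phi>\<close> because of its degree, so \<open>a q\<close> is not
  zero, provided that \<open>\<Phi>\<close> is prime.

  Primality of \<open>\<Phi>\<close> (\<open>cyclotomic_factor_prime\<close>) is where the order of \<open>2\<close> enters. It is obtained
  without constructing the field with \<open>2\<^sup>n\<close> elements, by working modulo \<open>x\<^sup>p - 1\<close>. There squaring sends
  \<open>a(x)\<close> to \<open>a(x\<^sup>2)\<close>, hence permutes coefficients by \<open>i \<mapsto> 2 i\<close>. As \<open>2\<close> generates the nonzero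
  residues, an idempotent has equal coefficients at all \<open>i \<noteq> 0\<close>, so it is \<open>0\<close> or \<open>1\<close> modulo \<open>\<Phi>\<close>
  (\<open>idempotent_cong_0_or_1\<close>). Squaring \<open>n\<close> times is the identity, so
  \<open>a\<^sup>N\<close> with \<open>N = 2\<^sup>n - 1\<close> is idempotent for every \<open>a\<close>: either \<open>a = a \<cdot> a\<^sup>N\<close> is \<open>0\<close> modulo \<open>\<Phi>\<close>, or \<open>a\<close> is
  a unit modulo \<open>\<Phi>\<close>.
\<close>

section \<open>Circuits in \<open>\<bbbF>\<^sub>2\<^sup>n\<close>\<close>

lemma bit_vec_self_add [simp]: "(v :: bit ^ 'n) + v = 0"
  by (simp add: vec_eq_iff)

lemma card_UNIV_bit [simp]: "CARD(bit) = 2"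
proof -
  have "(UNIV :: bit set) = {0, 1}" by auto
  then show ?thesis by (metis card_2_iff zero_neq_one)
qed

lemma finite_bit_vec [simp]: "finite (A :: (bit ^ 'n) set)"
proof -
  have "CARD(bit ^ 'n) > 0" by simp
  then have "finite (UNIV :: (bit ^ 'n) set)" by (rule card_ge_0_finite)
  then show ?thesis by (rule rev_finite_subset) simp
qed

lemma sum_sym_diff_bit_vec:
  "\<Sum>(sym_diff S T) = \<Sum>S + \<Sum>(T :: (bit ^ 'n) set)"
proof -
  have "\<Sum>S = \<Sum>(S - T) + \<Sum>(S \<inter> T)" "\<Sum>T = \<Sum>(T - S) + \<Sum>(S \<inter> T)"
    using sum.Int_Diff[of S "\<lambda>x. x" T] sum.Int_Diff[of T "\<lambda>x. x" S]
    by (simp_all add: add.commute Int_commute)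
  moreover have "\<Sum>(sym_diff S T) = \<Sum>(S - T) + \<Sum>(T - S)"
    by (rule sum.union_disjoint) auto
  ultimately have "\<Sum>S + \<Sum>T = \<Sum>(sym_diff S T) + (\<Sum>(S \<inter> T) + \<Sum>(S \<inter> T))"
    by (simp only: ac_simps)
  then show ?thesis by simp
qed

text \<open>
  Removing one vector \<open>v\<close> from a circuit leaves a set whose subsets have distinct sums: two subsets
  with equal sums have a symmetric difference that sums to \<open>0\<close> and misses \<open>v\<close>, hence is empty by
  minimality. Counting subsets bounds the size without any appeal to dimension.
\<close>

lemma card_circuit_le:
  assumes "circuit M (C :: (bit ^ 'n) set)"
  shows "card C \<le> CARD('n) + 1"
proof -
  obtain v where v: "v \<in> C" using assms by (auto simp: circuit_def)
  have "inj_on Sum (Pow (C - {v}))"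
  proof (rule inj_onI)
    fix S T assume ST: "S \<in> Pow (C - {v})" "T \<in> Pow (C - {v})" "\<Sum>S = \<Sum>T"
    have "eulerian (sym_diff S T)"
      using ST(3) by (simp add: eulerian_def sum_sym_diff_bit_vec)
    moreover have "sym_diff S T \<subset> C" using ST v by auto
    ultimately have "sym_diff S T = {}" using assms unfolding circuit_def by blast
    then show "S = T" by auto
  qed
  then have "card (Pow (C - {v})) \<le> card (UNIV :: (bit ^ 'n) set)"
    by (rule card_inj_on_le) auto
  then have "(2::nat) ^ (card C - 1) \<le> 2 ^ CARD('n)"
    using v by (simp add: card_Pow)
  then show ?thesis by simp
qed

lemma card_complete_matroid: "card (complete_matroid :: (bit ^ 'n) set) = 2 ^ CARD('n) - 1"
  by (simp add: complete_matroid_def card_Diff_singleton)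

lemma card_circuit_decomposition_ge:
  assumes "circuit_decomposition M (D :: (bit ^ 'n) set set)"
  shows "card M \<le> card D * (CARD('n) + 1)"
proof -
  have "card M \<le> (\<Sum>C\<in>D. card C)"
    using assms card_Union_le_sum_card[of D] by (simp add: circuit_decomposition_def)
  also have "\<dots> \<le> (\<Sum>C\<in>D. CARD('n) + 1)"
    using assms by (intro sum_mono card_circuit_le) (auto simp: circuit_decomposition_def)
  finally show ?thesis by simp
qed

section \<open>Squaring binary polynomials modulo \<open>x\<^sup>p - 1\<close>\<close>

text \<open>
  The simplifier turns a positive power of \<open>c :: bit\<close> into \<open>of_bool (c = 1)\<close>; this restores \<open>c\<close>.
\<close>

lemma of_bool_eq_bit: "of_bool (c = 1) = (c :: bit)"
  by (cases c) simp_all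

lemma bit_poly_two [simp]: "(2 :: bit poly) = 0"
  by (simp add: numeral_poly)

lemma bit_poly_square_sum:
  fixes f :: "'a \<Rightarrow> bit poly"
  assumes "finite A"
  shows "(\<Sum>i\<in>A. f i)\<^sup>2 = (\<Sum>i\<in>A. (f i)\<^sup>2)"
  using assms by induction (simp_all add: power2_sum)

text \<open>
  Residues modulo \<open>x\<^sup>p - 1\<close> form the group algebra of \<open>\<int>/p\<close> over \<open>\<bbbF>\<^sub>2\<close>: exponents may be reduced
  modulo \<open>p\<close>, and a residue has unique coefficients indexed by \<open>{..<p}\<close>. The ring modulo
  \<open>1 + x + \<dots> + x\<^sup>p\<^sup>-\<^sup>1\<close> lacks this symmetric basis, so squaring is analysed here.
\<close>

definition cyclic_modulus :: "nat \<Rightarrow> bit poly" where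
  "cyclic_modulus p = monom 1 p - 1"

lemma degree_cyclic_modulus:
  assumes "p > 0"
  shows "degree (cyclic_modulus p) = p"
proof -
  have "degree (monom (1 :: bit) p - 1) = degree (monom (1 :: bit) p)"
    unfolding diff_conv_add_uminus
    by (rule degree_add_eq_left) (use assms in \<open>simp add: degree_monom_eq\<close>)
  then show ?thesis by (simp add: cyclic_modulus_def degree_monom_eq)
qed

lemma cong_monom_mod:
  "[monom c k = monom c (k mod p)] (mod cyclic_modulus p)"
proof -
  have "[monom 1 p = 1] (mod cyclic_modulus p)"
    by (simp add: cong_iff_dvd_diff cyclic_modulus_def)
  then have "[monom 1 p ^ (k div p) * monom c (k mod p) = 1 ^ (k div p) * monom c (k mod p)]
      (mod cyclic_modulus p)"
    by (intro cong_mult cong_pow) auto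
  then show ?thesis by (simp add: monom_power mult_monom of_bool_eq_bit)
qed

lemma bit_poly_reduced_sum:
  assumes "p > 0"
  obtains c where "[a = (\<Sum>i<p. monom (c i) i)] (mod cyclic_modulus p)"
proof
  let ?r = "a mod cyclic_modulus p"
  have "cyclic_modulus p \<noteq> 0" using degree_cyclic_modulus[OF assms] assms by auto
  then have "?r = 0 \<or> degree ?r < p"
    using degree_mod_less[of "cyclic_modulus p" a] assms by (simp add: degree_cyclic_modulus)
  then have "degree ?r \<le> p - 1" using assms by auto
  then have "(\<Sum>i\<le>p - 1. monom (coeff ?r i) i) = ?r" by (rule poly_as_sum_of_monoms')
  moreover have "{..p - 1} = {..<p}" using assms by auto
  ultimately show "[a = (\<Sum>i<p. monom (coeff ?r i) i)] (mod cyclic_modulus p)"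
    by (simp add: cong_def)
qed

text \<open>
  In characteristic \<open>2\<close> squaring is additive and fixes the coefficients, which lie in \<open>\<bbbF>\<^sub>2\<close>, so it
  only doubles exponents.
\<close>

lemma bit_poly_pow_two_pow_cong:
  assumes "[a = (\<Sum>i<p. monom (c i) i)] (mod cyclic_modulus p)"
  shows "[a ^ 2 ^ k = (\<Sum>i<p. monom (c i) (2 ^ k * i mod p))] (mod cyclic_modulus p)"
proof (induction k)
  case 0
  then show ?case using assms by simp
next
  case (Suc k)
  have "[a ^ 2 ^ Suc k = (\<Sum>i<p. monom (c i) (2 ^ k * i mod p))\<^sup>2] (mod cyclic_modulus p)"
    using cong_pow[OF Suc.IH, of 2] by (simp add: power_mult [symmetric] mult.commute)
  also have "(\<Sum>i<p. monom (c i) (2 ^ k * i mod p))\<^sup>2 =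
      (\<Sum>i<p. monom (c i) (2 * (2 ^ k * i mod p)))"
    by (simp add: bit_poly_square_sum monom_power mult.commute of_bool_eq_bit)
  also have "[\<dots> = (\<Sum>i<p. monom (c i) (2 ^ Suc k * i mod p))] (mod cyclic_modulus p)"
  proof (rule cong_sum)
    fix i
    have "2 * (2 ^ k * i mod p) mod p = 2 ^ Suc k * i mod p"
      by (simp only: mod_mult_right_eq mult.assoc power_Suc)
    then show "[monom (c i) (2 * (2 ^ k * i mod p)) = monom (c i) (2 ^ Suc k * i mod p)]
        (mod cyclic_modulus p)"
      using cong_monom_mod[of "c i" "2 * (2 ^ k * i mod p)" p] by simp
  qed
  finally show ?case .
qed

lemma cong_cyclic_modulus_imp_eq:
  assumes "[a = b] (mod cyclic_modulus p)" "degree a < p" "degree b < p"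
  shows "a = b"
  using assms mod_poly_less[of _ "cyclic_modulus p"] degree_cyclic_modulus[of p]
  by (auto simp: cong_def)

section \<open>The polynomial \<open>1 + x + \<dots> + x\<^sup>p\<^sup>-\<^sup>1\<close> is prime\<close>

definition subset_poly :: "nat set \<Rightarrow> bit poly" where
  "subset_poly S = (\<Sum>i\<in>S. monom 1 i)"

lemma coeff_subset_poly:
  "finite S \<Longrightarrow> coeff (subset_poly S) i = of_bool (i \<in> S)"
  by (simp add: subset_poly_def coeff_sum of_bool_def)

lemma degree_subset_poly_le:
  assumes "S \<subseteq> {..<p}"
  shows "degree (subset_poly S) \<le> p - 1"
  using assms finite_subset[OF assms] by (intro degree_le) (auto simp: coeff_subset_poly)

lemma degree_subset_poly_lessThan: "degree (subset_poly {..<p}) = p - 1"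
proof (cases "p = 0")
  case False
  then have "p - 1 \<le> degree (subset_poly {..<p})"
    by (intro le_degree) (simp add: coeff_subset_poly)
  then show ?thesis using degree_subset_poly_le[of "{..<p}" p] by auto
qed (simp add: subset_poly_def)

lemma subset_poly_dvd_cyclic_modulus: "subset_poly {..<p} dvd cyclic_modulus p"
proof -
  have "monom 1 1 ^ p - 1 = (monom 1 1 - 1) * (\<Sum>i<p. monom (1 :: bit) 1 ^ i)"
    by (rule power_diff_1_eq)
  then show ?thesis by (simp add: monom_power cyclic_modulus_def subset_poly_def)
qed

text \<open>
  A nonzero multiple of \<open>1 + x + \<dots> + x\<^sup>p\<^sup>-\<^sup>1\<close> of degree at most \<open>p - 1\<close> is a constant multiple, and
  the only nonzero constant is \<open>1\<close>.
\<close>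

lemma cyclotomic_factor_not_dvd_subset_poly:
  assumes "S \<subset> {..<p}" "S \<noteq> {}"
  shows "\<not> subset_poly {..<p} dvd subset_poly S"
proof
  assume "subset_poly {..<p} dvd subset_poly S"
  then obtain q where q: "subset_poly S = subset_poly {..<p} * q" by (elim dvdE)
  have fin: "finite S" using assms(1) finite_subset by blast
  obtain s where "s \<in> S" using assms(2) by blast
  then have "coeff (subset_poly S) s \<noteq> 0" using fin by (simp add: coeff_subset_poly)
  then have nz: "subset_poly S \<noteq> 0" by auto
  then have "q \<noteq> 0" "subset_poly {..<p} \<noteq> 0" using q by auto
  then have "degree (subset_poly S) = p - 1 + degree q"
    using q by (simp add: degree_mult_eq degree_subset_poly_lessThan)
  then have "degree q = 0" using degree_subset_poly_le[of S p] assms(1) by auto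
  then obtain c where "q = [:c:]" by (rule degree_eq_zeroE)
  with \<open>q \<noteq> 0\<close> have "q = 1" by (cases c) auto
  with q have "coeff (subset_poly S) i = coeff (subset_poly {..<p}) i" for i by simp
  then have "of_bool (i \<in> S) = (of_bool (i \<in> {..<p}) :: bit)" for i
    using fin by (simp add: coeff_subset_poly)
  then have "i \<in> S \<longleftrightarrow> i \<in> {..<p}" for i
    by (metis of_bool_eq(1,2) zero_neq_one)
  then have "S = {..<p}" by blast
  then show False using assms(1) by simp
qed

lemma odd_prime_pow_two_surj:
  assumes "prime p" "odd p" "ord p 2 = p - 1" "i < p" "i \<noteq> 0"
  obtains k where "2 ^ k mod p = i"
proof -
  have "p > 1" using assms(1) prime_gt_1_nat by blast
  moreover have "residue_primroot p 2"
    using assms by (auto simp: residue_primroot_def totient_prime prime_gt_0_nat)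
  ultimately have "bij_betw (\<lambda>i. 2 ^ i mod p) {..<totient p} (totatives p)"
    by (rule residue_primroot_is_generator)
  moreover have "i \<in> totatives p"
    using assms by (simp add: totatives_prime)
  ultimately have "i \<in> (\<lambda>i. 2 ^ i mod p) ` {..<totient p}"
    by (simp only: bij_betw_imp_surj_on)
  then show ?thesis using that by blast
qed

text \<open>
  By idempotence the coefficients are invariant under \<open>i \<mapsto> 2 i\<close> on \<open>\<int>/p\<close>, whose only orbits are
  \<open>{0}\<close> and the set of nonzero residues. Hence \<open>e = c\<^sub>1 \<Phi> + (c\<^sub>0 - c\<^sub>1)\<close> modulo \<open>x\<^sup>p - 1\<close>.
\<close>

lemma idempotent_cong_0_or_1:
  fixes e :: "bit poly"
  assumes p: "prime p" "odd p" "ord p 2 = p - 1"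
    and idem: "[e\<^sup>2 = e] (mod cyclic_modulus p)"
  shows "[e = 0] (mod subset_poly {..<p}) \<or> [e = 1] (mod subset_poly {..<p})"
proof -
  let ?\<Phi> = "subset_poly {..<p}"
  have p1: "p > 1" using p(1) prime_gt_1_nat by blast
  obtain c where c: "[e = (\<Sum>i<p. monom (c i) i)] (mod cyclic_modulus p)"
    using bit_poly_reduced_sum[of p e] p1 by auto
  have "[(\<Sum>i<p. monom (c i) i) = (\<Sum>i<p. monom (c i) (2 * i mod p))] (mod cyclic_modulus p)"
    using c idem bit_poly_pow_two_pow_cong[OF c, of 1] by (simp add: cong_def)
  then have eq: "(\<Sum>i<p. monom (c i) i) = (\<Sum>i<p. monom (c i) (2 * i mod p))"
    by (rule cong_cyclic_modulus_imp_eq)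
      (use p1 in \<open>auto intro!: degree_sum_less intro: le_less_trans[OF degree_monom_le]\<close>)
  have step: "c (2 * j mod p) = c j" if "j < p" for j
  proof -
    have inj: "2 * i mod p = 2 * j mod p \<longleftrightarrow> i = j" if "i < p" for i
    proof
      assume "2 * i mod p = 2 * j mod p"
      moreover have "coprime 2 p" using p by simp
      ultimately have "[i = j] (mod p)"
        by (metis cong_def cong_mult_lcancel_nat coprime_commute)
      then show "i = j" using \<open>i < p\<close> \<open>j < p\<close> by (simp add: cong_def)
    qed simp
    have "c (2 * j mod p) = coeff (\<Sum>i<p. monom (c i) i) (2 * j mod p)"
      using p1 by (simp add: coeff_sum)
    also have "\<dots> = (\<Sum>i<p. if i = j then c i else 0)"
      unfolding eq coeff_sum by (intro sum.cong) (auto simp: inj)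
    finally show ?thesis using that by simp
  qed
  have pow: "c (2 ^ k mod p) = c 1" for k
  proof (induction k)
    case (Suc k)
    then show ?case using step[of "2 ^ k mod p"] p1 by (simp add: mod_mult_right_eq)
  qed (use p1 in simp)
  have const: "c i = c 1" if "i < p" "i \<noteq> 0" for i
    using odd_prime_pow_two_surj[OF p that] pow by metis
  \<comment> \<open>The coefficient \<open>c 1\<close> of \<open>?\<Phi>\<close> also contributes at \<open>0\<close>, which the constant corrects.\<close>
  have "(\<Sum>i<p. monom (c i) i) = smult (c 1) ?\<Phi> + [:c 0 - c 1:]"
  proof (rule poly_eqI)
    fix i
    have "coeff (\<Sum>i<p. monom (c i) i) i = (if i < p then c i else 0)"
      by (simp add: coeff_sum)
    also have "\<dots> = (if i < p then c 1 else 0) + (if i = 0 then c 0 - c 1 else 0)"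
    proof (cases "i = 0")
      case True
      have "c 0 = c 1 + (c 0 - c 1)" by (simp only: add_diff_cancel_left' add_diff_eq)
      then show ?thesis using True p1 by simp
    next
      case False
      then show ?thesis using const[of i] by simp
    qed
    also have "\<dots> = coeff (smult (c 1) ?\<Phi> + [:c 0 - c 1:]) i"
      by (cases i) (simp_all add: coeff_subset_poly)
    finally show "coeff (\<Sum>i<p. monom (c i) i) i = coeff (smult (c 1) ?\<Phi> + [:c 0 - c 1:]) i" .
  qed
  moreover have "[e = (\<Sum>i<p. monom (c i) i)] (mod ?\<Phi>)"
    using c subset_poly_dvd_cyclic_modulus by (rule cong_dvd_modulus)
  ultimately have "[e = [:c 0 - c 1:]] (mod ?\<Phi>)"
    by (simp add: cong_def mod_smult_left poly_mod_add_left)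
  then show ?thesis by (cases "c 0 - c 1") (auto simp flip: one_pCons)
qed

text \<open>
  The idempotent \<open>e\<close> attached to \<open>a\<close> is its power with exponent \<open>2\<^sup>p\<^sup>-\<^sup>1 - 1\<close>, which satisfies \<open>a e = a\<close>.
  If \<open>e\<close> is \<open>0\<close> modulo \<open>\<Phi>\<close>, so is \<open>a\<close>; if \<open>e\<close> is \<open>1\<close>, then \<open>b\<close> is congruent to \<open>e b\<close>, a multiple of
  \<open>a b\<close>.
\<close>

lemma cyclotomic_factor_prime:
  fixes a b :: "bit poly"
  assumes p: "prime p" "odd p" "ord p 2 = p - 1"
    and dvd: "subset_poly {..<p} dvd a * b"
  shows "subset_poly {..<p} dvd a \<or> subset_poly {..<p} dvd b"
proof -
  let ?\<Phi> = "subset_poly {..<p}"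
  have p1: "p > 1" using p(1) prime_gt_1_nat by blast
  obtain c where c: "[a = (\<Sum>i<p. monom (c i) i)] (mod cyclic_modulus p)"
    using bit_poly_reduced_sum[of p a] p1 by auto
  have "[2 ^ ord p 2 = 1] (mod p)" by (rule ord)
  then have two: "[2 ^ (p - 1) = 1] (mod p)" by (simp only: p(3))
  have "2 ^ (p - 1) * i mod p = i" if "i < p" for i
    using cong_scalar_right[OF two, of i] that by (simp add: cong_def)
  then have "(\<Sum>i<p. monom (c i) (2 ^ (p - 1) * i mod p)) = (\<Sum>i<p. monom (c i) i)"
    by (intro sum.cong) auto
  then have frob: "[a ^ 2 ^ (p - 1) = a] (mod cyclic_modulus p)"
    using bit_poly_pow_two_pow_cong[OF c, of "p - 1"] c by (metis cong_sym cong_trans)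
  \<comment> \<open>Splitting off two factors makes \<open>Suc N\<close> the exponent of the idempotent, with \<open>a ^ N\<close> a genuine
    power left to multiply \<open>a * ?e = a\<close> by.\<close>
  obtain N where N: "2 ^ (p - 1) = Suc (Suc N)"
  proof -
    have "(2::nat) \<le> 2 ^ (p - 1)" using p1 power_increasing[of 1 "p - 1" "2 :: nat"] by simp
    then have "2 ^ (p - 1) = Suc (Suc (2 ^ (p - 1) - 2))" by linarith
    then show ?thesis by (rule that)
  qed
  let ?e = "a ^ Suc N"
  have frob': "[a * ?e = a] (mod cyclic_modulus p)" using frob by (simp only: N power_Suc)
  have "[(a * ?e) * a ^ N = a * a ^ N] (mod cyclic_modulus p)"
    using frob' by (rule cong_scalar_right)
  moreover have "a * ?e * a ^ N = ?e\<^sup>2" by (simp add: power2_eq_square)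
  ultimately have "[?e\<^sup>2 = ?e] (mod cyclic_modulus p)" by (simp only: power_Suc)
  then consider "[?e = 0] (mod ?\<Phi>)" | "[?e = 1] (mod ?\<Phi>)"
    using idempotent_cong_0_or_1[OF p] by blast
  then show ?thesis
  proof cases
    case 1
    then have "?\<Phi> dvd a * ?e" by (simp only: cong_0_iff dvd_mult)
    moreover have "[a * ?e = a] (mod ?\<Phi>)"
      using frob' subset_poly_dvd_cyclic_modulus by (rule cong_dvd_modulus)
    ultimately show ?thesis using cong_dvd_iff by blast
  next
    case 2
    have "?e * b = a ^ N * (a * b)" by simp
    then have "?\<Phi> dvd ?e * b" using dvd by (simp only: dvd_mult)
    moreover have "[?e * b = 1 * b] (mod ?\<Phi>)" using 2 by (rule cong_scalar_right)
    ultimately show ?thesis using cong_dvd_iff[of "?e * b" "1 * b" ?\<Phi>] by simp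
  qed
qed

section \<open>Orbits of the cyclic shift\<close>

text \<open>
  The map \<open>ix\<close> enumerates the coordinates, so that for \<open>ix\<close> a bijection onto \<open>{..<degree m}\<close> this is
  the linear isomorphism from \<open>\<bbbF>\<^sub>2[x]/(m)\<close> onto \<open>\<bbbF>\<^sub>2\<^sup>n\<close> given by the basis of powers of \<open>x\<close>.
\<close>

definition residue_vec :: "('n \<Rightarrow> nat) \<Rightarrow> bit poly \<Rightarrow> bit poly \<Rightarrow> bit ^ 'n" where
  "residue_vec ix m q = (\<chi> i. coeff (q mod m) (ix i))"

lemma residue_vec_add: "residue_vec ix m (q + r) = residue_vec ix m q + residue_vec ix m r"
  by (simp add: residue_vec_def vec_eq_iff poly_mod_add_left)

lemma residue_vec_sum: "residue_vec ix m (\<Sum>i\<in>A. f i) = (\<Sum>i\<in>A. residue_vec ix m (f i))"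
  by (induction A rule: infinite_finite_induct)
    (simp_all add: residue_vec_add, simp_all add: residue_vec_def vec_eq_iff)

lemma residue_vec_cong: "[q = r] (mod m) \<Longrightarrow> residue_vec ix m q = residue_vec ix m r"
  by (simp add: residue_vec_def cong_def)

lemma residue_vec_eq_0_iff:
  assumes "bij_betw ix (UNIV :: 'n::finite set) {..<degree m}" "m \<noteq> 0"
  shows "residue_vec ix m q = (0 :: bit ^ 'n) \<longleftrightarrow> m dvd q"
proof
  assume *: "residue_vec ix m q = (0 :: bit ^ 'n)"
  have "coeff (q mod m) i = 0" for i
  proof (cases "i < degree m")
    case True
    then obtain j where "i = ix j" using assms(1) by (auto simp: bij_betw_def)
    then show ?thesis using * by (simp add: residue_vec_def vec_eq_iff)
  next
    case False
    then show ?thesis using degree_mod_less[OF assms(2), of q] by (auto intro: coeff_eq_0)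
  qed
  then have "q mod m = 0" by (simp add: poly_eq_iff)
  then show "m dvd q" by auto
qed (auto simp: residue_vec_def vec_eq_iff)

lemma residue_vec_eq_iff:
  assumes "bij_betw ix (UNIV :: 'n::finite set) {..<degree m}" "m \<noteq> 0"
  shows "residue_vec ix m q = (residue_vec ix m r :: bit ^ 'n) \<longleftrightarrow> [q = r] (mod m)"
proof -
  have "residue_vec ix m ((q - r) + r) = residue_vec ix m (q - r) + (residue_vec ix m r :: bit ^ 'n)"
    by (rule residue_vec_add)
  then show ?thesis
    using residue_vec_eq_0_iff[OF assms, of "q - r"] by (auto simp: cong_iff_dvd_diff)
qed

lemma residue_vec_surj:
  assumes "bij_betw ix (UNIV :: 'n::finite set) {..<degree m}"
  obtains q where "residue_vec ix m q = (v :: bit ^ 'n)"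
proof
  let ?q = "\<Sum>j\<in>UNIV. monom (v $ j) (ix j)"
  have less: "ix j < degree m" for j using assms by (auto simp: bij_betw_def)
  then have "degree ?q < degree m"
    by (intro degree_sum_less) (auto intro: le_less_trans[OF degree_monom_le] le_less_trans[OF le0])
  then have "?q mod m = ?q" by (rule mod_poly_less)
  moreover have "ix j = ix i \<longleftrightarrow> j = i" for i j
    using assms by (auto simp: bij_betw_def inj_on_def)
  ultimately show "residue_vec ix m ?q = v"
    by (simp add: residue_vec_def vec_eq_iff coeff_sum)
qed

text \<open>
  All exponents are allowed, not only those below \<open>p\<close>, which lets orbits be translated freely when
  two of them are compared.
\<close>

definition shift_orbit :: "('n \<Rightarrow> nat) \<Rightarrow> nat \<Rightarrow> bit poly \<Rightarrow> (bit ^ 'n) set" where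
  "shift_orbit ix p q = range (\<lambda>k. residue_vec ix (subset_poly {..<p}) (monom 1 k * q))"

context
  fixes p :: nat and ix :: "'n::finite \<Rightarrow> nat"
  assumes p: "prime p" "odd p" "ord p 2 = p - 1"
    and ix: "bij_betw ix UNIV {..<p - 1}"
begin

abbreviation "\<Phi> \<equiv> subset_poly {..<p}"
abbreviation "vec_of \<equiv> residue_vec ix \<Phi> :: bit poly \<Rightarrow> bit ^ 'n"
abbreviation "orbit \<equiv> shift_orbit ix p"

lemma p_gt_2: "p > 2"
  using p(1,2) prime_ge_2_nat[of p] by (cases "p = 2") auto

lemma Phi_nz: "\<Phi> \<noteq> 0"
  using degree_subset_poly_lessThan[of p] p_gt_2 by auto

lemma ix': "bij_betw ix UNIV {..<degree \<Phi>}"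
  using ix by (simp add: degree_subset_poly_lessThan)

lemmas vec_of_eq_0_iff = residue_vec_eq_0_iff[OF ix' Phi_nz]
lemmas vec_of_eq_iff = residue_vec_eq_iff[OF ix' Phi_nz]

lemma vec_of_shift_mod: "vec_of (monom 1 (k mod p) * q) = vec_of (monom 1 k * q)"
proof -
  have "[monom 1 k = monom 1 (k mod p)] (mod \<Phi>)"
    using cong_monom_mod subset_poly_dvd_cyclic_modulus by (rule cong_dvd_modulus)
  then show ?thesis by (rule residue_vec_cong[OF cong_scalar_right, OF cong_sym])
qed

lemma orbit_eq: "orbit q = (\<lambda>k. vec_of (monom 1 k * q)) ` {..<p}"
proof -
  have "vec_of (monom 1 k * q) \<in> (\<lambda>k. vec_of (monom 1 k * q)) ` {..<p}" for k
    using vec_of_shift_mod[of k q] p_gt_2 by (intro image_eqI[of _ _ "k mod p"]) auto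
  then show ?thesis by (auto simp: shift_orbit_def)
qed

lemma sum_shifts: "(\<Sum>i\<in>S. vec_of (monom 1 i * q)) = vec_of (subset_poly S * q)"
  by (simp only: subset_poly_def[of S] sum_distrib_right residue_vec_sum)

lemma sum_shifts_nonzero:
  assumes "\<not> \<Phi> dvd q" "S \<subset> {..<p}" "S \<noteq> {}"
  shows "(\<Sum>i\<in>S. vec_of (monom 1 i * q)) \<noteq> 0"
proof
  assume "(\<Sum>i\<in>S. vec_of (monom 1 i * q)) = 0"
  then have "\<Phi> dvd subset_poly S * q" by (simp only: sum_shifts vec_of_eq_0_iff)
  then show False
    using cyclotomic_factor_prime[OF p] cyclotomic_factor_not_dvd_subset_poly[OF assms(2,3)] assms(1)
    by blast
qed

lemma inj_on_shifts:
  assumes "\<not> \<Phi> dvd q"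
  shows "inj_on (\<lambda>k. vec_of (monom 1 k * q)) {..<p}"
proof (rule inj_onI, rule ccontr)
  fix i j assume ij: "i \<in> {..<p}" "j \<in> {..<p}" "i \<noteq> j"
    and eq: "vec_of (monom 1 i * q) = vec_of (monom 1 j * q)"
  have "card {i, j} \<noteq> card {..<p}" using ij p_gt_2 by simp
  then have "{i, j} \<noteq> {..<p}" by (rule contrapos_nn) (rule arg_cong)
  then have "{i, j} \<subset> {..<p}" using ij by blast
  then have "(\<Sum>k\<in>{i, j}. vec_of (monom 1 k * q)) \<noteq> 0"
    using assms by (intro sum_shifts_nonzero) simp_all
  moreover have "(\<Sum>k\<in>{i, j}. vec_of (monom 1 k * q)) =
      vec_of (monom 1 i * q) + vec_of (monom 1 j * q)"
    using ij(3) by simp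
  ultimately show False using eq by simp
qed

lemma card_orbit: "\<not> \<Phi> dvd q \<Longrightarrow> card (orbit q) = p"
  by (simp add: orbit_eq card_image inj_on_shifts)

text \<open>
  The orbit is parametrised injectively by \<open>{..<p}\<close>, so its subsets correspond to the index sets \<open>S\<close>;
  the sum is \<open>0\<close> for the full index set and nonzero for the nonempty proper ones.
\<close>

lemma circuit_orbit:
  assumes "\<not> \<Phi> dvd q"
  shows "circuit complete_matroid (orbit q)"
proof -
  note inj = inj_on_shifts[OF assms]
  have sum: "\<Sum>((\<lambda>k. vec_of (monom 1 k * q)) ` S) = (\<Sum>k\<in>S. vec_of (monom 1 k * q))"
    if "S \<subseteq> {..<p}" for S
    using inj_on_subset[OF inj that] by (simp add: sum.reindex)
  have "vec_of (monom 1 k * q) \<noteq> 0" if "k < p" for k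
  proof -
    have "card {k} \<noteq> card {..<p}" using p_gt_2 by simp
    then have "{k} \<noteq> {..<p}" by (rule contrapos_nn) (rule arg_cong)
    then have "{k} \<subset> {..<p}" using that by blast
    then show ?thesis using sum_shifts_nonzero[OF assms, of "{k}"] by simp
  qed
  then have "orbit q \<subseteq> complete_matroid" by (auto simp: orbit_eq complete_matroid_def)
  moreover have "orbit q \<noteq> {}" by (simp add: shift_orbit_def)
  moreover have "eulerian (orbit q)"
    using sum[of "{..<p}"] by (simp add: eulerian_def orbit_eq sum_shifts vec_of_eq_0_iff)
  moreover have "\<not> eulerian K" if K: "K \<subset> orbit q" "K \<noteq> {}" for K
  proof -
    obtain S where S: "S \<subseteq> {..<p}" "K = (\<lambda>k. vec_of (monom 1 k * q)) ` S"
      using K(1) by (metis orbit_eq psubset_imp_subset subset_imageE)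
    then have "S \<subset> {..<p}" "S \<noteq> {}" using K by (auto simp: orbit_eq)
    then show ?thesis using sum[OF S(1)] sum_shifts_nonzero[OF assms] S(2)
      by (simp add: eulerian_def)
  qed
  ultimately show ?thesis unfolding circuit_def by blast
qed

text \<open>
  If \<open>x\<^sup>i q\<close> and \<open>x\<^sup>j r\<close> agree modulo \<open>\<Phi>\<close>, multiply by a power of \<open>x\<close> that moves \<open>x\<^sup>j r\<close> to the given
  element \<open>x\<^sup>k r\<close>.
\<close>

lemma orbit_subset_if_meet:
  assumes "orbit q \<inter> orbit r \<noteq> {}"
  shows "orbit r \<subseteq> orbit q"
proof
  fix v assume "v \<in> orbit r"
  then obtain k where v: "v = vec_of (monom 1 k * r)" by (auto simp: shift_orbit_def)
  obtain i j where "vec_of (monom 1 i * q) = vec_of (monom 1 j * r)"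
    using assms by (auto simp: shift_orbit_def)
  then have ij: "[monom 1 i * q = monom 1 j * r] (mod \<Phi>)" by (simp add: vec_of_eq_iff)
  \<comment> \<open>\<open>x\<close> has inverse \<open>x ^ (p - 1)\<close>, so multiplying by \<open>x ^ l\<close> undoes \<open>x ^ j\<close> and then applies \<open>x ^ k\<close>.\<close>
  define l where "l = k + j * (p - 1)"
  have l: "(l + j) mod p = k mod p"
  proof -
    have "l + j = k + j * p" using p_gt_2 by (cases p) (auto simp: l_def)
    then show ?thesis by simp
  qed
  have "[monom 1 l * (monom 1 i * q) = monom 1 l * (monom 1 j * r)] (mod \<Phi>)"
    using ij by (rule cong_scalar_left)
  then have "vec_of (monom 1 (l + i) * q) = vec_of (monom 1 (l + j) * r)"
    by (simp add: vec_of_eq_iff mult.assoc [symmetric] mult_monom)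
  also have "\<dots> = v" using v l vec_of_shift_mod by metis
  finally show "v \<in> orbit q" by (auto simp: shift_orbit_def)
qed

lemma orbit_decomposition:
  defines "D \<equiv> orbit ` {q. \<not> \<Phi> dvd q}"
  shows "circuit_decomposition complete_matroid D" "p * card D = 2 ^ (p - 1) - 1"
proof -
  have disj: "pairwise disjnt D"
    unfolding pairwise_def disjnt_def D_def
    using orbit_subset_if_meet by (fastforce simp: Int_commute)
  have "v \<in> \<Union>D" if "v \<noteq> 0" for v
  proof -
    obtain q where q: "vec_of q = v" using residue_vec_surj[OF ix'] by blast
    then have "\<not> \<Phi> dvd q" using that vec_of_eq_0_iff by blast
    moreover have "v \<in> orbit q"
      unfolding shift_orbit_def using q by (intro image_eqI[of _ _ 0]) (auto simp: monom_0 simp flip: one_pCons)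
    ultimately show ?thesis by (auto simp: D_def)
  qed
  moreover have circ: "\<forall>C\<in>D. circuit complete_matroid C" using circuit_orbit by (auto simp: D_def)
  ultimately have Un: "\<Union>D = complete_matroid"
    unfolding circuit_def complete_matroid_def by blast
  show "circuit_decomposition complete_matroid D"
    using disj circ Un by (simp add: circuit_decomposition_def)
  have "card (\<Union>D) = (\<Sum>C\<in>D. card C)"
    using disj by (intro card_Union_disjoint) auto
  also have "\<dots> = (\<Sum>C\<in>D. p)" by (intro sum.cong) (auto simp: D_def card_orbit)
  finally have "p * card D = 2 ^ CARD('n) - 1"
    using Un by (simp add: card_complete_matroid mult.commute)
  moreover have "CARD('n) = p - 1" using bij_betw_same_card[OF ix] by simp
  ultimately show "p * card D = 2 ^ (p - 1) - 1" by simp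
qed

end

theorem theorem1p2:
  fixes p :: nat and M :: "(bit ^ 'n) set"
  assumes "prime p" and "odd p"
    and "ord p 2 = p - 1"
    and "CARD('n) = p - 1"
    and "M = complete_matroid"
  shows "real (min_circuits M) = (2 ^ (p - 1) - 1) / real p"
proof -
  have p0: "p > 0" using assms(1) prime_gt_0_nat by blast
  obtain ix :: "'n \<Rightarrow> nat" where ix: "bij_betw ix UNIV {..<p - 1}"
    using ex_bij_betw_finite_nat[of "UNIV :: 'n set"] assms(4) by (auto simp: atLeast0LessThan)
  obtain D where D: "circuit_decomposition M D" "p * card D = 2 ^ (p - 1) - 1"
    using orbit_decomposition[OF assms(1-3) ix] assms(5) by blast
  have "min_circuits M = card D"
    unfolding min_circuits_def
  proof (rule Least_equality)
    fix k assume "\<exists>D'. circuit_decomposition M D' \<and> card D' = k"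
    then obtain D' where D': "circuit_decomposition M D'" "card D' = k" by blast
    have "p * card D \<le> p * k"
      using card_circuit_decomposition_ge[OF D'(1)] D(2) D'(2) assms(4,5) p0
      by (simp add: card_complete_matroid mult.commute)
    then show "card D \<le> k" using p0 by simp
  qed (use D in blast)
  moreover have "real p * real (card D) = 2 ^ (p - 1) - 1"
    using arg_cong[OF D(2), of real] by (simp add: of_nat_diff)
  ultimately show ?thesis using p0 by (simp add: field_simps)
qed

end
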